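(* Suppose that $\mu$ is the operating mode of the system at time $t$, which is the beginning of a detection interval. Let $(x(t),v(t-1))\in\mathrm{Proj}_{(x,v_0)}\tilde O_{\infty,\mu}$, and $\|v(t-1)-r\|>\vartheta$ for some $\vartheta\in\mathbb{R}_{\ge0}$. Suppose that the auxiliary reference (AR) sequence $v(t),\dots,v(t+T_d-1)$ is computed via the optimization problem $$\max_{\kappa_j^i}\ \ \Omega\sum_{i=0}^{T_d-1}\sum_{j=1}^m\kappa_j^i-(1-\Omega)\hat J_d(v_0,\dots,v_{T_d-1})$$ subject to $\kappa_j^i\in[0,1]$, $v_0=v(t-1)+K_0(r(t)-v(t-1))$, $v_i=v_{i-1}+K_i(r(t+i)-v_{i-1})$ for $i=1,\dots,T_d-1$, $(x(t),v_0,\dots,v_{T_d-1})\in\tilde O_{\infty,\mu}$ (where $K_i=\mathrm{diag}\{\kappa^i_1,\dots,\kappa^i_m\}$), and the extra constraints $$\hat x(T_d|t,\bar\mu,K_\mu,G_\mu)\in\mathcal R_{\bar\mu}^{T_r},\qquad \hat z_1(k|t,\bar\mu,K_\mu,G_\mu)\in\mathcal Z_1^+,\qquad \hat z_2(k|t,\bar\mu,K_\mu,G_\mu)\in\mathcal Z_2^+\sim\mathcal P_\beta(k)$$ for all $k\in\{0,1,\dots,T_d\}$ and all $\bar\mu\in\mathcal M_\mu^+$, where $\Omega\in[0,1]$ is a design parameter. Then the AR sequence $v(t+i)=v_i^\ast$, $i\in\{0,\dots,T_d-1\}$, where $v_i^\ast$ is the optimal solution of this problem, results in the relaxed constraints being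 satisfied within the interval $[t,t+T_d-1]$. If the operating mode of the system remains constant over $[t,t+T_d-1]$, the computed AR sequence results in the constraints $\mathbb{E}[z_1(\cdot|\mu)]\in\mathcal Z_1$, $\mathbb{P}(z_2(\cdot|\mu)\in\mathcal Z_2)\ge\beta$ being satisfied within that interval.
   Context: Multi-mode system: for each mode $\mu$ in a finite set $\mathcal M$, $x(t+1|\mu)=A_{o,\mu}x(t|\mu)+B_{o,\mu}u(t|\mu)+\omega_\mu(t)$, $y(t|\mu)=Cx(t|\mu)+\xi(t)\in\mathbb{R}^m$, $x\in\mathbb{R}^n$, $u\in\mathbb{R}^p$; $\omega_\mu,\xi$ are mutually independent zero-mean Gaussian processes with covariances $H_{\omega_\mu},H_\xi$. The control law for mode $\mu$ is $u=K_\mu x+G_\mu v$ with AR $v(t)\in\mathbb{R}^m$; $A_\mu=A_{o,\mu}+B_{o,\mu}K_\mu$ is strictly Schur for every $\mu$, $B_\mu=B_{o,\mu}G_\mu$. Constrained outputs: $z_1(t|\mu)=L_xx(t|\mu)+L_vv(t)+\zeta(t)\in\mathbb{R}^{n_e}$, $z_2(t|\mu)=F_xx(t|\mu)+F_vv(t)+\varsigma(t)\in\mathbb{R}^{n_c}$, $\zeta(t)\sim\mathcal N(0,H_\zeta)$, $\varsigma(t)\sim\mathcal N(0,H_\varsigma)$. Nominal constraints: $\mathbb{E}[z_1(t|\mu)]\in\mathcal Z_1$, $\mathbb{P}(z_2(t|\mu)\in\mathcal Z_2)\ge\beta$, with $\mathcal Z_1,\mathcal Z_2$ compact, convex, containing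 the origin. The pairs $(L_x,A_\mu)$, $(F_x,A_\mu)$ are observable for all $\mu$. The desired reference is $r(\cdot)\in\mathbb{R}^m$, written $r$ for its current value. $\mathcal M_\mu^+$ is the set of successor modes of $\mu$; until a mode change is detected the gains $K_\mu,G_\mu$ remain in use. Standing assumptions: (i) the time between subsequent faults is large, so only one mode change needs to be considered at a time; (ii) constraints can be temporarily relaxed to the relaxed constraints $\mathbb{E}[z_1]\in\mathcal Z_1^+$, $\mathbb{P}(z_2\in\mathcal Z_2^+)\ge\beta$, with extended sets $\mathcal Z_1^+\supset\mathcal Z_1$, $\mathcal Z_2^+\supset\mathcal Z_2$, for at most $T_e\in\mathbb{Z}_{\ge2}$ steps. $T_d$ is the detection time (length of detection interval), $T_r$ the recovery time, $0<T_r<T_e-2T_d$. Notation: $X\oplus Y$ is the Minkowski sum (points identified with singletons), $X\sim Y=\{x:x+y\in X\ \forall y\in Y\}$ the Pontryagin difference, $\mathcal B_\epsilon$ the open ball of fixed radius $\epsilon>0$ about the origin, $\mathrm{Proj}_{(x,v_0)}$ projection onto the $(x,v_0)$ coordinates. Predictions: for a pair of matrices $(A,B)$, noise-free $\hat x(k+1|t)=A\hat x(k|t)+Bv(t+k)$, $\hat x(0|t)=x(t)$, $\hat z_1(k|t)=L_x\hat x(k|t)+L_vv(t+k)$, $\hat z_2(k|t)=F_x\hat x(k|t)+F_vv(t+k)$; noise-driven $\tilde x(k+1|t)=A\tilde x(k|t)+\omega(t+k)$, $\tilde x(0|t)=0$, $\tilde z_2(k|t)=F_x\tilde x(k|t)+\varsigma(t+k)$;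 $\mathcal P_\beta(k)$ is the confidence ellipsoid of level $\beta$, $\mathbb{P}(\tilde z_2(k|t)\in\mathcal P_\beta(k))=\beta$, for the system under consideration. The arguments $(\cdot|t,\mu)$ mean $(A,B)=(A_\mu,B_\mu)$; $(\cdot|t,\bar\mu,K_\mu,G_\mu)$ mean $(A,B)=(A_{o,\bar\mu}+B_{o,\bar\mu}K_\mu,\ B_{o,\bar\mu}G_\mu)$, i.e. the gains for $\mu$ applied to system $\bar\mu$, with $v(t+k)=v_k$ for $k\le T_d-1$ and, at $k=T_d$, the last value $v_{T_d-1}$ held. Set $\tilde O_{\infty,\mu}$: with $T=T_d-1$, for $x\in\mathbb{R}^n$, $v_0,\dots,v_T\in\mathbb{R}^m$, let $\hat x_T$ be the noise-free prediction (mode $\mu$) at step $T$ from $x$ under $v_0,\dots,v_{T-1}$, and for $k\ge0$ let $\hat z_1(k|x,v_0,\dots,v_T)=L_xA_\mu^k(\hat x_T-(I_n-A_\mu)^{-1}B_\mu v_T)+(L_x(I_n-A_\mu)^{-1}B_\mu+L_v)v_T$, $\hat z_2(k|x,v_0,\dots,v_T)=F_xA_\mu^k(\hat x_T-(I_n-A_\mu)^{-1}B_\mu v_T)+(F_x(I_n-A_\mu)^{-1}B_\mu+F_v)v_T$. Let $\Phi_k$ be the set of $(x,v_0,\dots,v_T)$ with $\hat z_1(k|x,v_0,\dots,v_T)\in\mathcal Z_1$, $\hat z_2(k|x,v_0,\dots,v_T)\in\mathcal Z_2\sim\mathcal P_\beta(k)$; let $\bar\Phi$ be the set of $(x,v_0,\dots,v_T)$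 such that the noise-free predicted outputs from $x$ under $v_0,\dots,v_T$ lie in $\mathcal Z_1$ and $\mathcal Z_2\sim\mathcal P_\beta(k)$, respectively, for $k=0,\dots,T$, and $(L_x(I_n-A_\mu)^{-1}B_\mu+L_v)v_T\oplus\mathcal B_\epsilon\subset\mathcal Z_1$, $(F_x(I_n-A_\mu)^{-1}B_\mu+F_v)v_T\oplus\mathcal B_\epsilon\subset\bigcap_{k\ge0}(\mathcal Z_2\sim\mathcal P_\beta(k))$. Then $\tilde O_{\infty,\mu}=\bar\Phi\cap\bigcap_{k\ge0}\Phi_k$. Recoverable set: $\mathcal R_{\mu}^{T_r}$ is the set of states $x(t)$ for which there exist $v(t),\dots,v(t+T_r-1)$ such that $\hat z_1(k|t,\mu)\in\mathcal Z_1^+$, $\hat z_2(k|t,\mu)\in\mathcal Z_2^+\sim\mathcal P_\beta(k)$ for all $k\in\{0,\dots,T_r-1\}$, and $(\hat x(T_r|t,\mu),v(t+T_r-1))\in\mathrm{Proj}_{(x,v_0)}\tilde O_{\infty,\mu}$. Detection cost: let $\tilde{\mathcal M}$ be the set of models $\tilde\mu$ indexed by $\bar\mu\in\{\mu\}\cup\mathcal M_\mu^+$, with matrices $(A_{\tilde\mu},B_{\tilde\mu})=(A_{o,\bar\mu}+B_{o,\bar\mu}K_\mu,B_{o,\bar\mu}G_\mu)$, process noise covariance $H_{\omega_{\bar\mu}}$, and known prior probabilities $\mathbb{P}(\tilde\mu)$. Then $$\hat J_d(v_0,\dots,v_{T_d-1})=\tfrac12\sum_{\tilde\mu\in\tilde{\mathcal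 M}}\sum_{\check\mu\in\tilde{\mathcal M}}\sqrt{\mathbb{P}(\tilde\mu)\mathbb{P}(\check\mu)}\,e^{-\rho_{\tilde\mu\check\mu}},$$ $$\rho_{\tilde\mu\check\mu}=\tfrac14(\eta_{\tilde\mu}-\eta_{\check\mu})^\top(\Psi_{\tilde\mu}+\Psi_{\check\mu})^{-1}(\eta_{\tilde\mu}-\eta_{\check\mu})+\tfrac12\ln\frac{\det\big((\Psi_{\tilde\mu}+\Psi_{\check\mu})/2\big)}{\sqrt{\det\Psi_{\tilde\mu}\det\Psi_{\check\mu}}},$$ where $\eta_{\tilde\mu}$ stacks $C\hat x(0|t,\tilde\mu),\dots,C\hat x(T_d|t,\tilde\mu)$ (noise-free predictions with model $\tilde\mu$ under $v_0,\dots,v_{T_d-1}$), $\Psi_{\tilde\mu}$ is block diagonal with blocks $C\Sigma(0)C^\top,\ C\Sigma(1|\tilde\mu)C^\top+H_\xi,\dots,C\Sigma(T_d|\tilde\mu)C^\top+H_\xi$, and $\Sigma(k+1|\tilde\mu)=A_{\tilde\mu}\Sigma(k|\tilde\mu)A_{\tilde\mu}^\top+H_{\omega_{\bar\mu}}$ with $\Sigma(0)$ the covariance of the state measurement or estimate.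
   Formalization: A mode change in the detection interval is assumed to act from its first transition (mode then constant, μ or one successor); for a change strictly inside the interval the relaxed-constraint claim is false, since predictions for the successor mode start from x(t). *)

theory Defs
  imports "HOL-Probability.Probability"
begin

section \<open>Sets, matrices, Gaussian vectors\<close>

definition pontryagin_diff :: "'a::ab_group_add set \<Rightarrow> 'a set \<Rightarrow> 'a set"
  where "pontryagin_diff X Y = {x. \<forall>y\<in>Y. x + y \<in> X}"

definition diag_mat :: "real^'m \<Rightarrow> real^'m^'m"
  where "diag_mat d = (\<chi> i j. if i = j then d $ i else 0)"

definition schur_stable :: "real^'n^'n \<Rightarrow> bool"
  where "schur_stable A \<longleftrightarrow>
    (\<forall>(l::complex) (w::complex^'n). w \<noteq> 0 \<and> (\<chi> i j. complex_of_real (A $ i $ j)) *v w = l *s w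
       \<longrightarrow> norm l < 1)"

text \<open>The power operation on \<^typ>\<open>real^'n^'n\<close> is componentwise, so products with matrix powers
  are written as iterates of the map \<^term>\<open>(*v) A\<close>.  Observability of a pair: the initial state is
  determined by the free output response.\<close>

definition observable_pair :: "real^'n^'l \<Rightarrow> real^'n^'n \<Rightarrow> bool"
  where "observable_pair L A \<longleftrightarrow> inj (\<lambda>x (k::nat). L *v (((*v) A ^^ k) x))"

definition psd_matrix :: "real^'n^'n \<Rightarrow> bool"
  where "psd_matrix H \<longleftrightarrow> transpose H = H \<and> (\<forall>a. 0 \<le> a \<bullet> (H *v a))"

text \<open>A centred Gaussian vector with a possibly singular covariance \<open>H\<close>: every linear functional
  \<open>a \<bullet> X\<close> is centred normal with variance \<open>a \<bullet> H a\<close>.\<close>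

definition gaussian_vector :: "'o measure \<Rightarrow> real^'n^'n \<Rightarrow> ('o \<Rightarrow> real^'n) \<Rightarrow> bool"
  where "gaussian_vector M H X \<longleftrightarrow>
    psd_matrix H \<and> X \<in> borel_measurable M \<and>
    (\<forall>a. if a \<bullet> (H *v a) = 0 then AE \<omega> in M. a \<bullet> X \<omega> = 0
         else distributed M lborel (\<lambda>\<omega>. a \<bullet> X \<omega>) (normal_density 0 (sqrt (a \<bullet> (H *v a)))))"

definition cov_matrix :: "'o measure \<Rightarrow> ('o \<Rightarrow> real^'n) \<Rightarrow> real^'n^'n"
  where "cov_matrix M X =
    (\<chi> i j. \<integral>\<omega>. (X \<omega> $ i - (\<integral>\<omega>'. X \<omega>' $ i \<partial>M)) * (X \<omega> $ j - (\<integral>\<omega>'. X \<omega>' $ j \<partial>M)) \<partial>M)"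

text \<open>The ellipsoid with shape matrix \<open>c \<Sigma>\<close>, where \<open>\<Sigma>\<close> is the covariance of \<open>Z\<close>, is the image
  of the closed unit ball under any \<open>Q\<close> with \<open>Q Q\<^sup>T = c \<Sigma>\<close>; for nonsingular \<open>\<Sigma>\<close> and \<open>c > 0\<close> this is
  \<open>{z. z \<bullet> \<Sigma>\<^sup>-\<^sup>1 z \<le> c}\<close>.  The size \<open>c\<close> is the one giving probability \<open>\<beta>\<close>.\<close>

definition confidence_ellipsoid ::
    "'o measure \<Rightarrow> real \<Rightarrow> ('o \<Rightarrow> real^'n) \<Rightarrow> (real^'n) set \<Rightarrow> bool"
  where "confidence_ellipsoid M \<beta> Z E \<longleftrightarrow>
    (\<exists>(c::real) (Q::real^'n^'n). 0 \<le> c \<and> Q ** transpose Q = c *\<^sub>R cov_matrix M Z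
        \<and> E = (*v) Q ` cball 0 1)
    \<and> measure M {\<omega> \<in> space M. Z \<omega> \<in> E} = \<beta>"


section \<open>The multi-mode system\<close>

text \<open>Type parameters: modes \<open>'d\<close> and index types of the state (\<open>'n\<close>), control (\<open>'p\<close>),
  auxiliary reference and measured output (\<open>'m\<close>), and the constrained outputs \<open>z\<^sub>1\<close> (\<open>'e\<close>) and
  \<open>z\<^sub>2\<close> (\<open>'c\<close>).\<close>

record ('d, 'n, 'p, 'm, 'e, 'c) mmsys =
  modes :: "'d set"
  succ_modes :: "'d \<Rightarrow> 'd set"
  A_o :: "'d \<Rightarrow> real^'n^'n"
  B_o :: "'d \<Rightarrow> real^'p^'n"
  K_gain :: "'d \<Rightarrow> real^'n^'p"
  G_gain :: "'d \<Rightarrow> real^'m^'p"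
  C_out :: "real^'n^'m"
  L_x :: "real^'n^'e"
  L_v :: "real^'m^'e"
  F_x :: "real^'n^'c"
  F_v :: "real^'m^'c"
  H_omega :: "'d \<Rightarrow> real^'n^'n"
  H_xi :: "real^'m^'m"
  H_zeta :: "real^'e^'e"
  H_varsigma :: "real^'c^'c"
  Z1 :: "(real^'e) set"
  Z2 :: "(real^'c) set"
  Z1_ext :: "(real^'e) set"
  Z2_ext :: "(real^'c) set"
  conf_level :: real
  ball_radius :: real
  T_d :: nat
  T_r :: nat
  T_e :: nat

text \<open>Closed-loop matrices of the plant in mode \<open>\<nu>\<close> under the gains designed for mode \<open>g\<close>.\<close>

definition A_cl :: "('d, 'n::finite, 'p::finite, 'm::finite, 'e::finite, 'c::finite) mmsys
    \<Rightarrow> 'd \<Rightarrow> 'd \<Rightarrow> real^'n^'n"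
  where "A_cl S \<nu> g = A_o S \<nu> + B_o S \<nu> ** K_gain S g"

definition B_cl :: "('d, 'n::finite, 'p::finite, 'm::finite, 'e::finite, 'c::finite) mmsys
    \<Rightarrow> 'd \<Rightarrow> 'd \<Rightarrow> real^'m^'n"
  where "B_cl S \<nu> g = B_o S \<nu> ** G_gain S g"

text \<open>Borel measurability of \<open>Z2_ext\<close> is what makes the relaxed chance constraint meaningful.\<close>

definition mmsys_assms ::
    "('d, 'n::finite, 'p::finite, 'm::finite, 'e::finite, 'c::finite) mmsys \<Rightarrow> bool"
  where "mmsys_assms S \<longleftrightarrow>
    finite (modes S) \<and> (\<forall>\<mu>\<in>modes S. succ_modes S \<mu> \<subseteq> modes S) \<and>
    (\<forall>\<mu>\<in>modes S. schur_stable (A_cl S \<mu> \<mu>)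
       \<and> observable_pair (L_x S) (A_cl S \<mu> \<mu>) \<and> observable_pair (F_x S) (A_cl S \<mu> \<mu>)) \<and>
    compact (Z1 S) \<and> convex (Z1 S) \<and> 0 \<in> Z1 S \<and>
    compact (Z2 S) \<and> convex (Z2 S) \<and> 0 \<in> Z2 S \<and>
    Z1 S \<subseteq> Z1_ext S \<and> Z2 S \<subseteq> Z2_ext S \<and> Z2_ext S \<in> sets borel \<and>
    0 < ball_radius S \<and>
    1 \<le> T_d S \<and> 0 < T_r S \<and> T_r S + 2 * T_d S < T_e S \<and> 2 \<le> T_e S"

datatype noise_index = Process int | Measurement int

text \<open>For each mode, the process and measurement noises are mutually independent white Gaussian
  sequences.  They take values in different types, hence independence is expressed through the
  generated families of events.\<close>

definition noise_assms ::
    "('d, 'n::finite, 'p::finite, 'm::finite, 'e::finite, 'c::finite) mmsys \<Rightarrow> 'o measure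
     \<Rightarrow> ('d \<Rightarrow> int \<Rightarrow> 'o \<Rightarrow> real^'n) \<Rightarrow> (int \<Rightarrow> 'o \<Rightarrow> real^'m)
     \<Rightarrow> (int \<Rightarrow> 'o \<Rightarrow> real^'e) \<Rightarrow> (int \<Rightarrow> 'o \<Rightarrow> real^'c) \<Rightarrow> bool"
  where "noise_assms S M w \<xi> \<zeta> vsig \<longleftrightarrow>
    prob_space M \<and>
    (\<forall>\<mu>\<in>modes S. \<forall>s. gaussian_vector M (H_omega S \<mu>) (w \<mu> s)) \<and>
    (\<forall>s. gaussian_vector M (H_xi S) (\<xi> s)) \<and>
    (\<forall>s. gaussian_vector M (H_zeta S) (\<zeta> s)) \<and>
    (\<forall>s. gaussian_vector M (H_varsigma S) (vsig s)) \<and>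
    (\<forall>\<mu>\<in>modes S. prob_space.indep_sets M
       (\<lambda>i. case i of
           Process s \<Rightarrow> {w \<mu> s -` U \<inter> space M | U. U \<in> sets borel}
         | Measurement s \<Rightarrow> {\<xi> s -` U \<inter> space M | U. U \<in> sets borel}) UNIV)"

text \<open>Realised trajectory on the detection interval starting at \<open>t\<close>, with the gains of mode \<open>\<mu>\<close> in
  use.  \<open>\<sigma> s\<close> is the operating mode at time \<open>s\<close>; the transition from \<open>s\<close> to \<open>s + 1\<close> is governed by
  \<open>\<sigma> (s + 1)\<close>, so that a mode change occurring directly after \<open>t\<close> already affects the first
  transition of the interval.\<close>

definition realised_trajectory ::
    "('d, 'n::finite, 'p::finite, 'm::finite, 'e::finite, 'c::finite) mmsys \<Rightarrow> 'o measure
     \<Rightarrow> ('d \<Rightarrow> int \<Rightarrow> 'o \<Rightarrow> real^'n) \<Rightarrow> (int \<Rightarrow> 'o \<Rightarrow> real^'m)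
     \<Rightarrow> (int \<Rightarrow> 'o \<Rightarrow> real^'e) \<Rightarrow> (int \<Rightarrow> 'o \<Rightarrow> real^'c)
     \<Rightarrow> 'd \<Rightarrow> (int \<Rightarrow> 'd) \<Rightarrow> int \<Rightarrow> (int \<Rightarrow> real^'m)
     \<Rightarrow> (int \<Rightarrow> 'o \<Rightarrow> real^'n) \<Rightarrow> (int \<Rightarrow> 'o \<Rightarrow> real^'p) \<Rightarrow> (int \<Rightarrow> 'o \<Rightarrow> real^'m)
     \<Rightarrow> (int \<Rightarrow> 'o \<Rightarrow> real^'e) \<Rightarrow> (int \<Rightarrow> 'o \<Rightarrow> real^'c) \<Rightarrow> bool"
  where "realised_trajectory S M w \<xi> \<zeta> vsig \<mu> \<sigma> t v x u y z1 z2 \<longleftrightarrow>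
    (\<forall>s\<in>{t..<t + int (T_d S)}. \<forall>\<omega>\<in>space M.
       u s \<omega> = K_gain S \<mu> *v x s \<omega> + G_gain S \<mu> *v v s \<and>
       x (s + 1) \<omega> = A_o S (\<sigma> (s + 1)) *v x s \<omega> + B_o S (\<sigma> (s + 1)) *v u s \<omega>
                       + w (\<sigma> (s + 1)) s \<omega> \<and>
       y s \<omega> = C_out S *v x s \<omega> + \<xi> s \<omega> \<and>
       z1 s \<omega> = L_x S *v x s \<omega> + L_v S *v v s + \<zeta> s \<omega> \<and>
       z2 s \<omega> = F_x S *v x s \<omega> + F_v S *v v s + vsig s \<omega>)"

text \<open>At most one mode change: during the interval the plant either stays in \<open>\<mu>\<close> or, from its first
  transition on, is in one successor mode.  These are exactly the hypotheses between which the
  detection cost discriminates and for which the constraints of the optimization problem are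
  imposed; for a change in the middle of the interval those constraints give no guarantee.\<close>

definition at_most_one_mode_change ::
    "('d, 'n::finite, 'p::finite, 'm::finite, 'e::finite, 'c::finite) mmsys
     \<Rightarrow> 'd \<Rightarrow> (int \<Rightarrow> 'd) \<Rightarrow> int \<Rightarrow> bool"
  where "at_most_one_mode_change S \<mu> \<sigma> t \<longleftrightarrow>
    (\<exists>\<nu>\<in>insert \<mu> (succ_modes S \<mu>). \<forall>s\<in>{t<..<t + int (T_d S)}. \<sigma> s = \<nu>)"

definition constraints_at ::
    "'o measure \<Rightarrow> real \<Rightarrow> (real^'e) set \<Rightarrow> (real^'c) set
     \<Rightarrow> ('o \<Rightarrow> real^'e) \<Rightarrow> ('o \<Rightarrow> real^'c) \<Rightarrow> bool"
  where "constraints_at M \<beta> X1 X2 z1 z2 \<longleftrightarrow>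
    integrable M z1 \<and> (\<integral>\<omega>. z1 \<omega> \<partial>M) \<in> X1 \<and> measure M {\<omega> \<in> space M. z2 \<omega> \<in> X2} \<ge> \<beta>"


section \<open>Predictions\<close>

primrec x_hat :: "real^'n^'n \<Rightarrow> real^'m^'n \<Rightarrow> real^'n \<Rightarrow> (nat \<Rightarrow> real^'m) \<Rightarrow> nat \<Rightarrow> real^'n"
  where
    "x_hat A B x v 0 = x"
  | "x_hat A B x v (Suc k) = A *v x_hat A B x v k + B *v v k"

definition z1_hat :: "('d, 'n::finite, 'p::finite, 'm::finite, 'e::finite, 'c::finite) mmsys
    \<Rightarrow> 'd \<Rightarrow> 'd \<Rightarrow> real^'n \<Rightarrow> (nat \<Rightarrow> real^'m) \<Rightarrow> nat \<Rightarrow> real^'e"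
  where "z1_hat S \<nu> g x v k = L_x S *v x_hat (A_cl S \<nu> g) (B_cl S \<nu> g) x v k + L_v S *v v k"

definition z2_hat :: "('d, 'n::finite, 'p::finite, 'm::finite, 'e::finite, 'c::finite) mmsys
    \<Rightarrow> 'd \<Rightarrow> 'd \<Rightarrow> real^'n \<Rightarrow> (nat \<Rightarrow> real^'m) \<Rightarrow> nat \<Rightarrow> real^'c"
  where "z2_hat S \<nu> g x v k = F_x S *v x_hat (A_cl S \<nu> g) (B_cl S \<nu> g) x v k + F_v S *v v k"

primrec x_tilde :: "real^'n^'n \<Rightarrow> (int \<Rightarrow> 'o \<Rightarrow> real^'n) \<Rightarrow> int \<Rightarrow> nat \<Rightarrow> 'o \<Rightarrow> real^'n"
  where
    "x_tilde A W t 0 \<omega> = 0"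
  | "x_tilde A W t (Suc k) \<omega> = A *v x_tilde A W t k \<omega> + W (t + int k) \<omega>"

definition z2_tilde :: "('d, 'n::finite, 'p::finite, 'm::finite, 'e::finite, 'c::finite) mmsys
    \<Rightarrow> ('d \<Rightarrow> int \<Rightarrow> 'o \<Rightarrow> real^'n) \<Rightarrow> (int \<Rightarrow> 'o \<Rightarrow> real^'c) \<Rightarrow> int \<Rightarrow> 'd \<Rightarrow> 'd \<Rightarrow> nat
    \<Rightarrow> 'o \<Rightarrow> real^'c"
  where "z2_tilde S w vsig t \<nu> g k \<omega> =
    F_x S *v x_tilde (A_cl S \<nu> g) (w \<nu>) t k \<omega> + vsig (t + int k) \<omega>"


section \<open>Admissible and recoverable sets\<close>

text \<open>\<open>P \<nu> g k\<close> is the confidence ellipsoid at prediction step \<open>k\<close> for the plant in mode \<open>\<nu>\<close> with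
  the gains of mode \<open>g\<close>.  A finite sequence \<open>v\<^sub>0, \<dots>, v\<^sub>T\<close> is represented by a function on \<^typ>\<open>nat\<close>
  of which only the first \<open>T + 1\<close> values matter.\<close>

definition steady_gain :: "('d, 'n::finite, 'p::finite, 'm::finite, 'e::finite, 'c::finite) mmsys
    \<Rightarrow> 'd \<Rightarrow> real^'m^'n"
  where "steady_gain S \<mu> = matrix_inv (mat 1 - A_cl S \<mu> \<mu>) ** B_cl S \<mu> \<mu>"

text \<open>The deviation from steady state \<open>k\<close> steps after the end of the planned sequence, when its last
  value is held from then on.\<close>

definition deviation_after :: "('d, 'n::finite, 'p::finite, 'm::finite, 'e::finite, 'c::finite) mmsys
    \<Rightarrow> 'd \<Rightarrow> real^'n \<Rightarrow> (nat \<Rightarrow> real^'m) \<Rightarrow> nat \<Rightarrow> real^'n"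
  where "deviation_after S \<mu> x v k =
    (let T = T_d S - 1 in
       ((*v) (A_cl S \<mu> \<mu>) ^^ k)
         (x_hat (A_cl S \<mu> \<mu>) (B_cl S \<mu> \<mu>) x v T - steady_gain S \<mu> *v v T))"

definition Phi :: "('d, 'n::finite, 'p::finite, 'm::finite, 'e::finite, 'c::finite) mmsys
    \<Rightarrow> ('d \<Rightarrow> 'd \<Rightarrow> nat \<Rightarrow> (real^'c) set) \<Rightarrow> 'd \<Rightarrow> nat \<Rightarrow> ((real^'n) \<times> (nat \<Rightarrow> real^'m)) set"
  where "Phi S P \<mu> k = {(x, v).
    (let T = T_d S - 1 in
       L_x S *v deviation_after S \<mu> x v k + (L_x S ** steady_gain S \<mu> + L_v S) *v v T \<in> Z1 S \<and>
       F_x S *v deviation_after S \<mu> x v k + (F_x S ** steady_gain S \<mu> + F_v S) *v v T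
         \<in> pontryagin_diff (Z2 S) (P \<mu> \<mu> k))}"

definition Phi_bar :: "('d, 'n::finite, 'p::finite, 'm::finite, 'e::finite, 'c::finite) mmsys
    \<Rightarrow> ('d \<Rightarrow> 'd \<Rightarrow> nat \<Rightarrow> (real^'c) set) \<Rightarrow> 'd \<Rightarrow> ((real^'n) \<times> (nat \<Rightarrow> real^'m)) set"
  where "Phi_bar S P \<mu> = {(x, v).
    (let T = T_d S - 1 in
       (\<forall>k\<le>T. z1_hat S \<mu> \<mu> x v k \<in> Z1 S \<and>
              z2_hat S \<mu> \<mu> x v k \<in> pontryagin_diff (Z2 S) (P \<mu> \<mu> k)) \<and>
       (+) ((L_x S ** steady_gain S \<mu> + L_v S) *v v T) ` ball 0 (ball_radius S) \<subseteq> Z1 S \<and>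
       (+) ((F_x S ** steady_gain S \<mu> + F_v S) *v v T) ` ball 0 (ball_radius S)
         \<subseteq> (\<Inter>k. pontryagin_diff (Z2 S) (P \<mu> \<mu> k)))}"

definition O_tilde :: "('d, 'n::finite, 'p::finite, 'm::finite, 'e::finite, 'c::finite) mmsys
    \<Rightarrow> ('d \<Rightarrow> 'd \<Rightarrow> nat \<Rightarrow> (real^'c) set) \<Rightarrow> 'd \<Rightarrow> ((real^'n) \<times> (nat \<Rightarrow> real^'m)) set"
  where "O_tilde S P \<mu> = Phi_bar S P \<mu> \<inter> (\<Inter>k. Phi S P \<mu> k)"

definition proj_x_v0 :: "('a \<times> (nat \<Rightarrow> 'b)) set \<Rightarrow> ('a \<times> 'b) set"
  where "proj_x_v0 X = (\<lambda>(x, v). (x, v 0)) ` X"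

definition recoverable_set ::
    "('d, 'n::finite, 'p::finite, 'm::finite, 'e::finite, 'c::finite) mmsys
     \<Rightarrow> ('d \<Rightarrow> 'd \<Rightarrow> nat \<Rightarrow> (real^'c) set) \<Rightarrow> 'd \<Rightarrow> (real^'n) set"
  where "recoverable_set S P \<mu> = {x. \<exists>v.
    (\<forall>k<T_r S. z1_hat S \<mu> \<mu> x v k \<in> Z1_ext S \<and>
               z2_hat S \<mu> \<mu> x v k \<in> pontryagin_diff (Z2_ext S) (P \<mu> \<mu> k)) \<and>
    (x_hat (A_cl S \<mu> \<mu>) (B_cl S \<mu> \<mu>) x v (T_r S), v (T_r S - 1)) \<in> proj_x_v0 (O_tilde S P \<mu>)}"


section \<open>Detection cost\<close>

text \<open>The dimension of the stacked prediction \<open>\<eta>\<close> depends on the detection time, so stacked vectors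
  and matrices are functions on the finite index set of pairs (step, component).\<close>

definition det_on :: "'i set \<Rightarrow> ('i \<Rightarrow> 'i \<Rightarrow> real) \<Rightarrow> real"
  where "det_on I N = (\<Sum>p | p permutes I. of_int (sign p) * (\<Prod>i\<in>I. N i (p i)))"

definition inv_on :: "'i set \<Rightarrow> ('i \<Rightarrow> 'i \<Rightarrow> real) \<Rightarrow> 'i \<Rightarrow> 'i \<Rightarrow> real"
  where "inv_on I N = (THE R.
    (\<forall>i j. i \<notin> I \<or> j \<notin> I \<longrightarrow> R i j = 0) \<and>
    (\<forall>i\<in>I. \<forall>j\<in>I. (\<Sum>k\<in>I. N i k * R k j) = (if i = j then 1 else 0)))"

primrec Sigma_pred :: "real^'n^'n \<Rightarrow> real^'n^'n \<Rightarrow> real^'n^'n \<Rightarrow> nat \<Rightarrow> real^'n^'n"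
  where
    "Sigma_pred A H \<Sigma>0 0 = \<Sigma>0"
  | "Sigma_pred A H \<Sigma>0 (Suc k) = A ** Sigma_pred A H \<Sigma>0 k ** transpose A + H"

definition stack_index :: "('d, 'n::finite, 'p::finite, 'm::finite, 'e::finite, 'c::finite) mmsys
    \<Rightarrow> (nat \<times> 'm) set"
  where "stack_index S = {0..T_d S} \<times> UNIV"

definition eta :: "('d, 'n::finite, 'p::finite, 'm::finite, 'e::finite, 'c::finite) mmsys
    \<Rightarrow> 'd \<Rightarrow> real^'n \<Rightarrow> (nat \<Rightarrow> real^'m) \<Rightarrow> 'd \<Rightarrow> nat \<times> 'm \<Rightarrow> real"
  where "eta S \<mu> x v \<nu> = (\<lambda>(k, i). (C_out S *v x_hat (A_cl S \<nu> \<mu>) (B_cl S \<nu> \<mu>) x v k) $ i)"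

definition Psi :: "('d, 'n::finite, 'p::finite, 'm::finite, 'e::finite, 'c::finite) mmsys
    \<Rightarrow> real^'n^'n \<Rightarrow> 'd \<Rightarrow> 'd \<Rightarrow> nat \<times> 'm \<Rightarrow> nat \<times> 'm \<Rightarrow> real"
  where "Psi S \<Sigma>0 \<mu> \<nu> = (\<lambda>(k, i) (l, j).
    if k = l then
      (C_out S ** Sigma_pred (A_cl S \<nu> \<mu>) (H_omega S \<nu>) \<Sigma>0 k ** transpose (C_out S)
        + (if k = 0 then 0 else H_xi S)) $ i $ j
    else 0)"

definition rho :: "('d, 'n::finite, 'p::finite, 'm::finite, 'e::finite, 'c::finite) mmsys
    \<Rightarrow> real^'n^'n \<Rightarrow> 'd \<Rightarrow> real^'n \<Rightarrow> (nat \<Rightarrow> real^'m) \<Rightarrow> 'd \<Rightarrow> 'd \<Rightarrow> real"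
  where "rho S \<Sigma>0 \<mu> x v \<nu> \<nu>' =
    (let I = stack_index S;
         d = (\<lambda>a. eta S \<mu> x v \<nu> a - eta S \<mu> x v \<nu>' a);
         N = (\<lambda>a b. Psi S \<Sigma>0 \<mu> \<nu> a b + Psi S \<Sigma>0 \<mu> \<nu>' a b)
     in 1/4 * (\<Sum>a\<in>I. \<Sum>b\<in>I. d a * inv_on I N a b * d b)
        + 1/2 * ln (det_on I (\<lambda>a b. N a b / 2)
                     / sqrt (det_on I (Psi S \<Sigma>0 \<mu> \<nu>) * det_on I (Psi S \<Sigma>0 \<mu> \<nu>'))))"

definition detection_cost ::
    "('d, 'n::finite, 'p::finite, 'm::finite, 'e::finite, 'c::finite) mmsys
     \<Rightarrow> real^'n^'n \<Rightarrow> ('d \<Rightarrow> real) \<Rightarrow> 'd \<Rightarrow> real^'n \<Rightarrow> (nat \<Rightarrow> real^'m) \<Rightarrow> real"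
  where "detection_cost S \<Sigma>0 prior \<mu> x v =
    1/2 * (\<Sum>\<nu>\<in>insert \<mu> (succ_modes S \<mu>). \<Sum>\<nu>'\<in>insert \<mu> (succ_modes S \<mu>).
             sqrt (prior \<nu> * prior \<nu>') * exp (- rho S \<Sigma>0 \<mu> x v \<nu> \<nu>'))"


section \<open>The optimization problem\<close>

text \<open>The decision variable \<open>\<kappa>\<^sub>j\<^sup>i\<close> is \<open>\<kappa> i $ j\<close>.\<close>

primrec ar_sequence ::
    "(int \<Rightarrow> real^'m) \<Rightarrow> int \<Rightarrow> real^'m \<Rightarrow> (nat \<Rightarrow> real^'m) \<Rightarrow> nat \<Rightarrow> real^'m"
  where
    "ar_sequence r t v' \<kappa> 0 = v' + diag_mat (\<kappa> 0) *v (r t - v')"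
  | "ar_sequence r t v' \<kappa> (Suc i) =
       ar_sequence r t v' \<kappa> i
       + diag_mat (\<kappa> (Suc i)) *v (r (t + int (Suc i)) - ar_sequence r t v' \<kappa> i)"

definition feasible :: "('d, 'n::finite, 'p::finite, 'm::finite, 'e::finite, 'c::finite) mmsys
    \<Rightarrow> ('d \<Rightarrow> 'd \<Rightarrow> nat \<Rightarrow> (real^'c) set) \<Rightarrow> 'd \<Rightarrow> real^'n \<Rightarrow> (int \<Rightarrow> real^'m) \<Rightarrow> int \<Rightarrow> real^'m
    \<Rightarrow> (nat \<Rightarrow> real^'m) \<Rightarrow> bool"
  where "feasible S P \<mu> x r t v' \<kappa> \<longleftrightarrow>
    (let v = ar_sequence r t v' \<kappa>;
         vh = (\<lambda>k. v (min k (T_d S - 1)))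
     in (\<forall>i<T_d S. \<forall>j. 0 \<le> \<kappa> i $ j \<and> \<kappa> i $ j \<le> 1) \<and>
        (x, v) \<in> O_tilde S P \<mu> \<and>
        (\<forall>\<nu>\<in>succ_modes S \<mu>.
           x_hat (A_cl S \<nu> \<mu>) (B_cl S \<nu> \<mu>) x vh (T_d S) \<in> recoverable_set S P \<nu> \<and>
           (\<forall>k\<le>T_d S. z1_hat S \<nu> \<mu> x vh k \<in> Z1_ext S \<and>
                      z2_hat S \<nu> \<mu> x vh k \<in> pontryagin_diff (Z2_ext S) (P \<nu> \<mu> k))))"

definition objective :: "('d, 'n::finite, 'p::finite, 'm::finite, 'e::finite, 'c::finite) mmsys
    \<Rightarrow> real^'n^'n \<Rightarrow> ('d \<Rightarrow> real) \<Rightarrow> real \<Rightarrow> 'd \<Rightarrow> real^'n \<Rightarrow> (int \<Rightarrow> real^'m) \<Rightarrow> int \<Rightarrow> real^'m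
    \<Rightarrow> (nat \<Rightarrow> real^'m) \<Rightarrow> real"
  where "objective S \<Sigma>0 prior \<Omega> \<mu> x r t v' \<kappa> =
    \<Omega> * (\<Sum>i<T_d S. \<Sum>j\<in>UNIV. \<kappa> i $ j)
    - (1 - \<Omega>) * detection_cost S \<Sigma>0 prior \<mu> x (ar_sequence r t v' \<kappa>)"

definition optimal_solution ::
    "('d, 'n::finite, 'p::finite, 'm::finite, 'e::finite, 'c::finite) mmsys
     \<Rightarrow> ('d \<Rightarrow> 'd \<Rightarrow> nat \<Rightarrow> (real^'c) set) \<Rightarrow> real^'n^'n \<Rightarrow> ('d \<Rightarrow> real) \<Rightarrow> real \<Rightarrow> 'd \<Rightarrow> real^'n
     \<Rightarrow> (int \<Rightarrow> real^'m) \<Rightarrow> int \<Rightarrow> real^'m \<Rightarrow> (nat \<Rightarrow> real^'m) \<Rightarrow> bool"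
  where "optimal_solution S P \<Sigma>0 prior \<Omega> \<mu> x r t v' \<kappa> \<longleftrightarrow>
    feasible S P \<mu> x r t v' \<kappa> \<and>
    (\<forall>\<kappa>'. feasible S P \<mu> x r t v' \<kappa>' \<longrightarrow>
       objective S \<Sigma>0 prior \<Omega> \<mu> x r t v' \<kappa>' \<le> objective S \<Sigma>0 prior \<Omega> \<mu> x r t v' \<kappa>)"

end

theory Submission
  imports Defs
begin

text \<open>
  On the detection interval the plant is a single linear system: the gains of mode \<open>\<mu>\<close> are in use
  throughout, and all transitions inside the interval are those of one mode \<open>\<nu>\<close>, which is \<open>\<mu>\<close>
  itself or one of its successors.  By linearity the realised state is the noise-free prediction
  plus the noise-driven state (\<open>closed_loop_state_split\<close>).  The noise-driven part is centred, so the
  mean of \<open>z\<^sub>1\<close> is the predicted \<open>z\<^sub>1\<close>; and \<open>z\<^sub>2\<close> is the predicted \<open>z\<^sub>2\<close> plus a disturbance that falls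
  into the confidence ellipsoid with probability \<open>\<beta>\<close>.  If the prediction lies in the Pontryagin
  difference of the constraint set and the ellipsoid, then \<open>z\<^sub>2\<close> is in the constraint set on that
  event (\<open>measure_tightened_constraint\<close>).  Thus tightened constraints on the predictions imply the
  stochastic constraints on the outputs (\<open>constraints_at_if_predicted\<close>).

  The optimizer is feasible, so both kinds of constraints on the predictions are at hand:
  membership in the admissible set gives the nominal ones for \<open>\<nu> = \<mu>\<close>, and the extra constraints
  give the relaxed ones for each successor mode.  The nominal constraints imply the relaxed ones,
  since the constraint sets are nested.
\<close>


section \<open>Centred Gaussian vectors\<close>

text \<open>Componentwise: a component with zero variance vanishes almost surely, any other one has a
  centred normal density.\<close>

lemma gaussian_vector_centred:
  fixes X :: "'o \<Rightarrow> real^'n"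
  assumes M: "prob_space M" and X: "gaussian_vector M H X"
  shows "integrable M X" "integral\<^sup>L M X = 0"
proof -
  interpret prob_space M by fact
  have meas [measurable]: "X \<in> borel_measurable M"
    using X by (simp add: gaussian_vector_def)
  have comp: "integrable M (\<lambda>\<omega>. X \<omega> \<bullet> a) \<and> (\<integral>\<omega>. X \<omega> \<bullet> a \<partial>M) = 0" for a
  proof (cases "a \<bullet> (H *v a) = 0")
    case True
    then have "AE \<omega> in M. X \<omega> \<bullet> a = 0"
      using X by (simp add: gaussian_vector_def inner_commute)
    then show ?thesis
      using integrable_cong_AE[of "\<lambda>\<omega>. X \<omega> \<bullet> a" M "\<lambda>_. 0"]
        integral_cong_AE[of "\<lambda>\<omega>. X \<omega> \<bullet> a" M "\<lambda>_. 0"] by simp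
  next
    case False
    define sd where "sd = sqrt (a \<bullet> (H *v a))"
    have "0 \<le> a \<bullet> (H *v a)"
      using X by (simp add: gaussian_vector_def psd_matrix_def)
    with False have sd: "0 < sd" by (simp add: sd_def)
    have "\<forall>b. if b \<bullet> (H *v b) = 0 then AE \<omega> in M. b \<bullet> X \<omega> = 0
         else distributed M lborel (\<lambda>\<omega>. b \<bullet> X \<omega>) (normal_density 0 (sqrt (b \<bullet> (H *v b))))"
      using X unfolding gaussian_vector_def by blast
    from spec[OF this, of a] False
    have D: "distributed M lborel (\<lambda>\<omega>. X \<omega> \<bullet> a) (normal_density 0 sd)"
      by (simp add: sd_def inner_commute)
    have "integrable lborel (\<lambda>z. normal_density 0 sd z * z)"
      using integrable_normal_moment_nz_1[OF sd, of 0] .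
    then have "integrable M (\<lambda>\<omega>. X \<omega> \<bullet> a)"
      using distributed_integrable[OF D, of "\<lambda>z. z"] by simp
    moreover have "(\<integral>\<omega>. X \<omega> \<bullet> a \<partial>M) = 0"
      using normal_distributed_expectation[OF sd D] .
    ultimately show ?thesis by simp
  qed
  have "integrable M (\<lambda>\<omega>. \<Sum>b\<in>Basis. (X \<omega> \<bullet> b) *\<^sub>R b)"
    using comp by (intro Bochner_Integration.integrable_sum integrable_scaleR_left) auto
  then show int: "integrable M X"
    unfolding euclidean_representation .
  show "integral\<^sup>L M X = 0"
  proof (rule euclidean_eqI)
    fix b :: "real^'n"
    have "integral\<^sup>L M X \<bullet> b = (\<integral>\<omega>. X \<omega> \<bullet> b \<partial>M)"
      by (rule integral_inner_left[symmetric]) (rule int)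
    then show "integral\<^sup>L M X \<bullet> b = 0 \<bullet> b"
      using comp[of b] by (metis inner_zero_left)
  qed
qed

lemma matrix_vector_mul_centred:
  fixes X :: "'o \<Rightarrow> real^'n" and D :: "real^'n^'k"
  assumes "integrable M X" "integral\<^sup>L M X = 0"
  shows "integrable M (\<lambda>\<omega>. D *v X \<omega>)" "(\<integral>\<omega>. D *v X \<omega> \<partial>M) = 0"
proof -
  have "bounded_linear ((*v) D)" by simp
  from integrable_bounded_linear[OF this assms(1)] integral_bounded_linear[OF this assms(1)]
  show "integrable M (\<lambda>\<omega>. D *v X \<omega>)" "(\<integral>\<omega>. D *v X \<omega> \<partial>M) = 0"
    unfolding assms(2) by simp_all
qed


section \<open>Predictions and noise-driven outputs\<close>

lemma x_hat_cong:
  "(\<And>i. i < k \<Longrightarrow> v i = v' i) \<Longrightarrow> x_hat A B x v k = x_hat A B x v' k"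
  by (induction k) auto

lemma z_hat_cong:
  assumes "\<And>i. i \<le> k \<Longrightarrow> v i = v' i"
  shows "z1_hat S \<nu> g x v k = z1_hat S \<nu> g x v' k" "z2_hat S \<nu> g x v k = z2_hat S \<nu> g x v' k"
proof -
  have "x_hat A B x v k = x_hat A B x v' k" for A B
    using assms by (intro x_hat_cong) simp
  with assms[of k]
  show "z1_hat S \<nu> g x v k = z1_hat S \<nu> g x v' k" "z2_hat S \<nu> g x v k = z2_hat S \<nu> g x v' k"
    by (simp_all add: z1_hat_def z2_hat_def)
qed

lemma x_tilde_centred:
  assumes "\<And>s. integrable M (W s)" "\<And>s. integral\<^sup>L M (W s) = 0"
  shows "integrable M (x_tilde A W t k) \<and> integral\<^sup>L M (x_tilde A W t k) = 0"
proof (induction k)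
  case (Suc k)
  have "integrable M (\<lambda>\<omega>. A *v x_tilde A W t k \<omega>)" "(\<integral>\<omega>. A *v x_tilde A W t k \<omega> \<partial>M) = 0"
    using Suc matrix_vector_mul_centred by blast+
  with assms[of "t + int k"] show ?case by simp
qed simp

lemma closed_loop_state_split:
  assumes "x t = xt"
    and "\<And>i. i < k \<Longrightarrow> x (t + int (Suc i)) = A *v x (t + int i) + B *v v i + W (t + int i) \<omega>"
  shows "x (t + int k) = x_hat A B xt v k + x_tilde A W t k \<omega>"
  using assms(2)
proof (induction k)
  case 0
  then show ?case using assms(1) by simp
next
  case (Suc k)
  then have "x (t + int k) = x_hat A B xt v k + x_tilde A W t k \<omega>" by simp
  with Suc.prems[of k] show ?case
    by (simp add: matrix_vector_right_distrib algebra_simps)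
qed


section \<open>From predicted to stochastic constraints\<close>

text \<open>On the event that the disturbance falls into \<open>E\<close>, the constraint holds by definition of the
  Pontryagin difference.  The event that the constraint holds has to be measurable, since a set
  outside the \<open>\<sigma>\<close>-algebra has measure \<open>0\<close>.\<close>

lemma measure_tightened_constraint:
  fixes Z :: "'o \<Rightarrow> 'b::real_normed_vector"
  assumes "prob_space M" and "(\<lambda>\<omega>. h + Z \<omega>) \<in> borel_measurable M" and "X \<in> sets borel"
    and "h \<in> pontryagin_diff X E"
  shows "measure M {\<omega> \<in> space M. Z \<omega> \<in> E} \<le> measure M {\<omega> \<in> space M. h + Z \<omega> \<in> X}"
proof -
  interpret prob_space M by fact
  have "{\<omega> \<in> space M. h + Z \<omega> \<in> X} \<in> sets M"
    using assms(2,3) by measurable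
  moreover have "{\<omega> \<in> space M. Z \<omega> \<in> E} \<subseteq> {\<omega> \<in> space M. h + Z \<omega> \<in> X}"
    using assms(4) by (auto simp: pontryagin_diff_def)
  ultimately show ?thesis by (intro finite_measure_mono)
qed

lemma pontryagin_diff_mono: "X \<subseteq> Y \<Longrightarrow> pontryagin_diff X E \<subseteq> pontryagin_diff Y E"
  by (auto simp: pontryagin_diff_def)

text \<open>The core of the proof, for an arbitrary plant mode \<open>\<nu>\<close> under the gains of mode \<open>g\<close> and for
  arbitrary constraint sets, so that it serves the nominal and the relaxed constraints alike.  The
  output at step \<open>k\<close> depends on the transitions before it only, hence on the operating modes at times
  \<open>t + 1, \<dots>, t + k\<close>.\<close>

lemma constraints_at_if_predicted:
  assumes noise: "noise_assms S M w \<xi> \<zeta> vsig" and \<nu>: "\<nu> \<in> modes S"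
    and ellipsoid: "confidence_ellipsoid M \<beta> (z2_tilde S w vsig t \<nu> g k) E"
    and trajectory: "realised_trajectory S M w \<xi> \<zeta> vsig g \<sigma> t v x u y z1 z2"
    and initial: "\<forall>\<omega>\<in>space M. x t \<omega> = xt"
    and k: "k < T_d S" and mode: "\<And>s. t < s \<Longrightarrow> s \<le> t + int k \<Longrightarrow> \<sigma> s = \<nu>"
    and X2: "X2 \<in> sets borel"
    and z1_hat: "z1_hat S \<nu> g xt (\<lambda>i. v (t + int i)) k \<in> X1"
    and z2_hat: "z2_hat S \<nu> g xt (\<lambda>i. v (t + int i)) k \<in> pontryagin_diff X2 E"
  shows "constraints_at M \<beta> X1 X2 (z1 (t + int k)) (z2 (t + int k))"
proof -
  interpret prob_space M using noise by (simp add: noise_assms_def)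
  let ?A = "A_cl S \<nu> g" and ?B = "B_cl S \<nu> g" and ?v = "\<lambda>i. v (t + int i)"
  let ?e = "x_tilde ?A (w \<nu>) t k"
  let ?h1 = "z1_hat S \<nu> g xt ?v k" and ?h2 = "z2_hat S \<nu> g xt ?v k"
  have centred_w: "integrable M (w \<nu> s)" "integral\<^sup>L M (w \<nu> s) = 0" for s
  proof -
    have "gaussian_vector M (H_omega S \<nu>) (w \<nu> s)"
      using noise \<nu> by (simp add: noise_assms_def)
    from gaussian_vector_centred[OF prob_space_axioms this]
    show "integrable M (w \<nu> s)" "integral\<^sup>L M (w \<nu> s) = 0" .
  qed
  have centred_\<zeta>: "integrable M (\<zeta> s)" "integral\<^sup>L M (\<zeta> s) = 0" for s
  proof -
    have "gaussian_vector M (H_zeta S) (\<zeta> s)"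
      using noise by (simp add: noise_assms_def)
    from gaussian_vector_centred[OF prob_space_axioms this]
    show "integrable M (\<zeta> s)" "integral\<^sup>L M (\<zeta> s) = 0" .
  qed
  have [measurable]: "vsig s \<in> borel_measurable M" for s
    using noise by (auto simp: noise_assms_def gaussian_vector_def)
  have centred_e: "integrable M ?e" "integral\<^sup>L M ?e = 0"
    using x_tilde_centred[of M "w \<nu>", OF centred_w] by blast+
  have centred_image: "integrable M (\<lambda>\<omega>. D *v ?e \<omega>)" "(\<integral>\<omega>. D *v ?e \<omega> \<partial>M) = 0" for D
    using matrix_vector_mul_centred[OF centred_e] by blast+
  have state: "x (t + int k) \<omega> = x_hat ?A ?B xt ?v k + ?e \<omega>" if \<omega>: "\<omega> \<in> space M" for \<omega>
  proof (rule closed_loop_state_split)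
    show "x t \<omega> = xt" using initial \<omega> by simp
  next
    fix i assume i: "i < k"
    let ?s = "t + int i"
    have s: "?s \<in> {t..<t + int (T_d S)}" "\<sigma> (?s + 1) = \<nu>"
      using i k mode[of "?s + 1"] by auto
    have "x (?s + 1) \<omega> = A_o S \<nu> *v x ?s \<omega>
        + B_o S \<nu> *v (K_gain S g *v x ?s \<omega> + G_gain S g *v v ?s) + w \<nu> ?s \<omega>"
      using trajectory \<omega> s unfolding realised_trajectory_def by metis
    also have "\<dots> = ?A *v x ?s \<omega> + ?B *v v ?s + w \<nu> ?s \<omega>"
      by (simp add: A_cl_def B_cl_def matrix_vector_right_distrib matrix_vector_mult_add_rdistrib
          matrix_vector_mul_assoc add.assoc)
    finally show "x (t + int (Suc i)) \<omega> = ?A *v x ?s \<omega> + ?B *v v ?s + w \<nu> ?s \<omega>"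
      by (simp add: algebra_simps)
  qed
  have outputs: "z1 (t + int k) \<omega> = ?h1 + (L_x S *v ?e \<omega> + \<zeta> (t + int k) \<omega>)"
      "z2 (t + int k) \<omega> = ?h2 + z2_tilde S w vsig t \<nu> g k \<omega>" if \<omega>: "\<omega> \<in> space M" for \<omega>
  proof -
    have "t + int k \<in> {t..<t + int (T_d S)}" using k by simp
    with trajectory \<omega>
    have "z1 (t + int k) \<omega> = L_x S *v x (t + int k) \<omega> + L_v S *v ?v k + \<zeta> (t + int k) \<omega>"
      "z2 (t + int k) \<omega> = F_x S *v x (t + int k) \<omega> + F_v S *v ?v k + vsig (t + int k) \<omega>"
      unfolding realised_trajectory_def by blast+
    then show "z1 (t + int k) \<omega> = ?h1 + (L_x S *v ?e \<omega> + \<zeta> (t + int k) \<omega>)"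
      "z2 (t + int k) \<omega> = ?h2 + z2_tilde S w vsig t \<nu> g k \<omega>"
      by (simp_all add: state[OF \<omega>] z1_hat_def z2_hat_def z2_tilde_def
          matrix_vector_right_distrib algebra_simps)
  qed
  have z1_centred: "integrable M (\<lambda>\<omega>. ?h1 + (L_x S *v ?e \<omega> + \<zeta> (t + int k) \<omega>))"
    "(\<integral>\<omega>. ?h1 + (L_x S *v ?e \<omega> + \<zeta> (t + int k) \<omega>) \<partial>M) = ?h1"
    using centred_\<zeta>[of "t + int k"] centred_image[of "L_x S"] by (simp_all add: prob_space)
  have "integrable M (z1 (t + int k))" "integral\<^sup>L M (z1 (t + int k)) = ?h1"
    using z1_centred outputs(1)
    by (simp_all cong: Bochner_Integration.integrable_cong Bochner_Integration.integral_cong)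
  moreover have "\<beta> \<le> measure M {\<omega> \<in> space M. z2 (t + int k) \<omega> \<in> X2}"
  proof -
    have [measurable]: "(\<lambda>\<omega>. F_x S *v ?e \<omega>) \<in> borel_measurable M"
      using centred_image(1) by (rule borel_measurable_integrable)
    have "(\<lambda>\<omega>. ?h2 + z2_tilde S w vsig t \<nu> g k \<omega>) \<in> borel_measurable M"
      unfolding z2_tilde_def by measurable
    from measure_tightened_constraint[OF prob_space_axioms this X2 z2_hat]
    have "\<beta> \<le> measure M {\<omega> \<in> space M. ?h2 + z2_tilde S w vsig t \<nu> g k \<omega> \<in> X2}"
      using ellipsoid by (simp add: confidence_ellipsoid_def)
    also have "{\<omega> \<in> space M. ?h2 + z2_tilde S w vsig t \<nu> g k \<omega> \<in> X2}
        = {\<omega> \<in> space M. z2 (t + int k) \<omega> \<in> X2}"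
      using outputs(2) by auto
    finally show ?thesis .
  qed
  ultimately show ?thesis using z1_hat by (simp add: constraints_at_def)
qed


section \<open>Constraints on the predictions at a feasible point\<close>

lemma feasible_nominal_prediction:
  assumes "feasible S P \<mu> xt r t v' \<kappa>" and "k < T_d S"
  shows "z1_hat S \<mu> \<mu> xt (ar_sequence r t v' \<kappa>) k \<in> Z1 S"
    and "z2_hat S \<mu> \<mu> xt (ar_sequence r t v' \<kappa>) k \<in> pontryagin_diff (Z2 S) (P \<mu> \<mu> k)"
  using assms by (auto simp: feasible_def O_tilde_def Phi_bar_def Let_def)

text \<open>Holding the last value of the planned sequence affects the step \<open>k = T_d\<close> only, which lies
  beyond the interval.\<close>

lemma feasible_relaxed_prediction:
  assumes "feasible S P \<mu> xt r t v' \<kappa>" and "k < T_d S" and "\<nu> \<in> succ_modes S \<mu>"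
  shows "z1_hat S \<nu> \<mu> xt (ar_sequence r t v' \<kappa>) k \<in> Z1_ext S"
    and "z2_hat S \<nu> \<mu> xt (ar_sequence r t v' \<kappa>) k \<in> pontryagin_diff (Z2_ext S) (P \<nu> \<mu> k)"
proof -
  let ?v = "ar_sequence r t v' \<kappa>"
  let ?vh = "\<lambda>k. ?v (min k (T_d S - 1))"
  have "z1_hat S \<nu> \<mu> xt ?v k = z1_hat S \<nu> \<mu> xt ?vh k"
    "z2_hat S \<nu> \<mu> xt ?v k = z2_hat S \<nu> \<mu> xt ?vh k"
    by (rule z_hat_cong; use assms(2) in \<open>simp add: min_absorb1\<close>)+
  moreover have "z1_hat S \<nu> \<mu> xt ?vh k \<in> Z1_ext S"
    "z2_hat S \<nu> \<mu> xt ?vh k \<in> pontryagin_diff (Z2_ext S) (P \<nu> \<mu> k)"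
    using assms unfolding feasible_def Let_def by auto
  ultimately show "z1_hat S \<nu> \<mu> xt ?v k \<in> Z1_ext S"
    "z2_hat S \<nu> \<mu> xt ?v k \<in> pontryagin_diff (Z2_ext S) (P \<nu> \<mu> k)" by simp_all
qed


section \<open>Constraint satisfaction during the detection interval\<close>

theorem theorem17:
  fixes S :: "('d, 'n::finite, 'p::finite, 'm::finite, 'e::finite, 'c::finite) mmsys"
    and M :: "'o measure"
    and w :: "'d \<Rightarrow> int \<Rightarrow> 'o \<Rightarrow> real^'n"
    and \<xi> :: "int \<Rightarrow> 'o \<Rightarrow> real^'m"
    and \<zeta> :: "int \<Rightarrow> 'o \<Rightarrow> real^'e"
    and vsig :: "int \<Rightarrow> 'o \<Rightarrow> real^'c"
    and P :: "'d \<Rightarrow> 'd \<Rightarrow> nat \<Rightarrow> (real^'c) set"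
    and \<mu> :: 'd and \<sigma> :: "int \<Rightarrow> 'd"
    and t :: int and r v :: "int \<Rightarrow> real^'m" and xt :: "real^'n"
    and x :: "int \<Rightarrow> 'o \<Rightarrow> real^'n" and u :: "int \<Rightarrow> 'o \<Rightarrow> real^'p" and y :: "int \<Rightarrow> 'o \<Rightarrow> real^'m"
    and z1 :: "int \<Rightarrow> 'o \<Rightarrow> real^'e" and z2 :: "int \<Rightarrow> 'o \<Rightarrow> real^'c"
    and \<theta> \<Omega> :: real and \<Sigma>0 :: "real^'n^'n" and prior :: "'d \<Rightarrow> real"
    and \<kappa> :: "nat \<Rightarrow> real^'m"
  assumes system: "mmsys_assms S"
    and noise: "noise_assms S M w \<xi> \<zeta> vsig"
    and ellipsoids: "\<forall>\<nu>\<in>modes S. \<forall>g\<in>modes S. \<forall>k.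
          confidence_ellipsoid M (conf_level S) (z2_tilde S w vsig t \<nu> g k) (P \<nu> g k)"
    and mode: "\<mu> \<in> modes S" "\<sigma> t = \<mu>"
    and single_change: "at_most_one_mode_change S \<mu> \<sigma> t"
    and trajectory: "realised_trajectory S M w \<xi> \<zeta> vsig \<mu> \<sigma> t v x u y z1 z2"
    and current_state: "\<forall>\<omega>\<in>space M. x t \<omega> = xt"
    and admissible: "(xt, v (t - 1)) \<in> proj_x_v0 (O_tilde S P \<mu>)"
    and not_converged: "0 \<le> \<theta>" "norm (v (t - 1) - r t) > \<theta>"
    and cost_data: "psd_matrix \<Sigma>0" "\<forall>\<nu>\<in>insert \<mu> (succ_modes S \<mu>). 0 \<le> prior \<nu>"
          "sum prior (insert \<mu> (succ_modes S \<mu>)) = 1"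
    and weight: "0 \<le> \<Omega>" "\<Omega> \<le> 1"
    and optimal: "optimal_solution S P \<Sigma>0 prior \<Omega> \<mu> xt r t (v (t - 1)) \<kappa>"
    and applied: "\<forall>i<T_d S. v (t + int i) = ar_sequence r t (v (t - 1)) \<kappa> i"
  shows "(\<forall>s\<in>{t..t + int (T_d S) - 1}.
            constraints_at M (conf_level S) (Z1_ext S) (Z2_ext S) (z1 s) (z2 s)) \<and>
         ((\<forall>s\<in>{t..t + int (T_d S) - 1}. \<sigma> s = \<mu>) \<longrightarrow>
            (\<forall>s\<in>{t..t + int (T_d S) - 1}.
               constraints_at M (conf_level S) (Z1 S) (Z2 S) (z1 s) (z2 s)))"
proof -
  let ?v = "ar_sequence r t (v (t - 1)) \<kappa>"
  have feas: "feasible S P \<mu> xt r t (v (t - 1)) \<kappa>"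
    using optimal by (simp add: optimal_solution_def)
  have sets: "Z1 S \<subseteq> Z1_ext S" "Z2 S \<subseteq> Z2_ext S" "Z2 S \<in> sets borel" "Z2_ext S \<in> sets borel"
    and succ: "succ_modes S \<mu> \<subseteq> modes S"
    using system mode(1) by (auto simp: mmsys_assms_def borel_compact)
  have step: "\<exists>k<T_d S. s = t + int k" if "s \<in> {t..t + int (T_d S) - 1}" for s
    using that by (intro exI[of _ "nat (s - t)"]) auto
  have output_constraints: "constraints_at M (conf_level S) X1 X2 (z1 (t + int k)) (z2 (t + int k))"
    if k: "k < T_d S" and \<nu>: "\<nu> \<in> modes S"
      and \<sigma>: "\<And>s. t < s \<Longrightarrow> s \<le> t + int k \<Longrightarrow> \<sigma> s = \<nu>" and X2: "X2 \<in> sets borel"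
      and pred: "z1_hat S \<nu> \<mu> xt ?v k \<in> X1"
        "z2_hat S \<nu> \<mu> xt ?v k \<in> pontryagin_diff X2 (P \<nu> \<mu> k)"
    for k \<nu> X1 X2
  proof -
    have "z1_hat S \<nu> \<mu> xt (\<lambda>i. v (t + int i)) k = z1_hat S \<nu> \<mu> xt ?v k"
      "z2_hat S \<nu> \<mu> xt (\<lambda>i. v (t + int i)) k = z2_hat S \<nu> \<mu> xt ?v k"
      by (rule z_hat_cong; use applied k in simp)+
    moreover have "confidence_ellipsoid M (conf_level S) (z2_tilde S w vsig t \<nu> \<mu> k) (P \<nu> \<mu> k)"
      using ellipsoids \<nu> mode(1) by blast
    ultimately show ?thesis
      using constraints_at_if_predicted[OF noise \<nu> _ trajectory current_state k \<sigma> X2] pred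
      by metis
  qed
  note nominal = feasible_nominal_prediction[OF feas]
  obtain \<nu> where \<nu>: "\<nu> = \<mu> \<or> \<nu> \<in> succ_modes S \<mu>" and \<sigma>: "\<forall>s\<in>{t<..<t + int (T_d S)}. \<sigma> s = \<nu>"
    using single_change by (auto simp: at_most_one_mode_change_def)
  have "constraints_at M (conf_level S) (Z1_ext S) (Z2_ext S) (z1 (t + int k)) (z2 (t + int k))"
    if k: "k < T_d S" for k
  proof (rule output_constraints[OF k])
    show "\<nu> \<in> modes S" using \<nu> succ mode(1) by auto
    show "\<sigma> s = \<nu>" if "t < s" "s \<le> t + int k" for s
      using \<sigma> k that by simp
    show "z1_hat S \<nu> \<mu> xt ?v k \<in> Z1_ext S"
      using \<nu> nominal(1)[OF k] sets(1) feasible_relaxed_prediction(1)[OF feas k] by blast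
    show "z2_hat S \<nu> \<mu> xt ?v k \<in> pontryagin_diff (Z2_ext S) (P \<nu> \<mu> k)"
      using \<nu> nominal(2)[OF k] pontryagin_diff_mono[OF sets(2)]
        feasible_relaxed_prediction(2)[OF feas k] by blast
  qed (rule sets(4))
  moreover have "constraints_at M (conf_level S) (Z1 S) (Z2 S) (z1 (t + int k)) (z2 (t + int k))"
    if "\<forall>s\<in>{t..t + int (T_d S) - 1}. \<sigma> s = \<mu>" and k: "k < T_d S" for k
    using that(1) k by (intro output_constraints[OF k mode(1) _ sets(3) nominal[OF k]]) simp
  ultimately show ?thesis
    using step by blast
qed

end
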